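(* Suppose that the source term $g$ admits a finite spectral decomposition $g=\sum_{k} g_k\Phi_k$, that $\lambda^*\ge 0$, and that $\max_k|\lambda_k+\omega^2|\,T>2$. Then, starting from zero, the fixed-point iteration $v\mapsto\mathcal{G}_{T,g}v$ converges, and the limit $u$ solves the Helmholtz problem $$\omega^2u+\mathcal{H}u=-g \text{ in } \Omega^{\#},\qquad u=0 \text{ on } \partial\Omega^{\#}.$$
   Context: $\omega$ is the constant angular frequency and $T>0$ is a time length. $\Omega^{\#}$ is an enlarged domain containing the domain of interest $\Omega$; $c(x)$ is the spatially varying wave speed; $W(x)$ is a non-negative smooth function vanishing in $\Omega$; and $\mathcal{H}u:=c^2(x)\Delta u+\mathrm{i}W(x)u$, with the homogeneous Dirichlet condition $u=0$ on $\partial\Omega^{\#}$. $\Phi_k$ denotes an eigenfunction of $\mathcal{H}$ corresponding to the complex-valued eigenvalue $\lambda_k$, i.e. $\mathcal{H}\Phi_k=\lambda_k\Phi_k$, and $\lambda^*:=\min_k\operatorname{Im}(\lambda_k)$. For any $v$, the operator $\mathcal{G}_{T,g}$ is defined by $$\mathcal{G}_{T,g}v:=\frac1T\int_0^T\exp(\mathrm{i}\omega^2t)\,\tilde v(t)\,dt,$$ where $\tilde v(t)$ solves the abstract ordinary differential equation $$\partial_t\tilde v-\mathrm{i}\mathcal{H}\tilde v=\mathrm{i}g\exp(-\mathrm{i}\omega^2t)\quad\text{for all } t\in(0,T),\qquad \tilde v(0)=v.$$ The analysis is a formal spectral one: the functions are expanded in the eigenfunctions $\Phi_k$, and the finite decomposition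 of $g$ reduces the problem to a finite-dimensional setting, treated eigenmode by eigenmode.
   Formalization: Adds the hypothesis that λ_k + ω² ≠ 0 for every k with g_k ≠ 0; without it the claim fails, since a resonant mode with g_k ≠ 0 makes the iteration diverge even when max_k|λ_k+ω²|T > 2. *)

theory Defs
  imports "HOL-Analysis.Analysis"
begin

text \<open>Continuous differentiability of order \<open>k\<close> on an open set, via iterated partial derivatives.\<close>

fun Ck_on :: "nat \<Rightarrow> ('a::euclidean_space \<Rightarrow> 'b::real_normed_vector) \<Rightarrow> 'a set \<Rightarrow> bool" where
  "Ck_on 0 f S \<longleftrightarrow> continuous_on S f"
| "Ck_on (Suc k) f S \<longleftrightarrow>
     f differentiable_on S \<and> (\<forall>b\<in>Basis. Ck_on k (\<lambda>x. frechet_derivative f (at x) b) S)"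

definition smooth_on :: "('a::euclidean_space \<Rightarrow> 'b::real_normed_vector) \<Rightarrow> 'a set \<Rightarrow> bool" where
  "smooth_on f S \<longleftrightarrow> (\<forall>k. Ck_on k f S)"

definition laplacian :: "('a::euclidean_space \<Rightarrow> 'b::real_normed_vector) \<Rightarrow> 'a \<Rightarrow> 'b" where
  "laplacian f x =
     (\<Sum>b\<in>Basis. frechet_derivative (\<lambda>y. frechet_derivative f (at y) b) (at x) b)"

definition H_op ::
  "('a::euclidean_space \<Rightarrow> real) \<Rightarrow> ('a \<Rightarrow> real) \<Rightarrow> ('a \<Rightarrow> complex) \<Rightarrow> 'a \<Rightarrow> complex" where
  "H_op c W u x = of_real ((c x)\<^sup>2) * laplacian u x + \<i> * of_real (W x) * u x"

text \<open>Functions are total, but only their values on the closure of the domain \<open>D\<close> are meaningful;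
  every condition below is restricted to that set.\<close>

definition dirichlet_space :: "'a::euclidean_space set \<Rightarrow> ('a \<Rightarrow> complex) set" where
  "dirichlet_space D =
     {u. Ck_on 2 u D \<and> continuous_on (closure D) u \<and> (\<forall>x\<in>frontier D. u x = 0)}"

definition eigenfunction ::
  "'a::euclidean_space set \<Rightarrow> ('a \<Rightarrow> real) \<Rightarrow> ('a \<Rightarrow> real) \<Rightarrow> complex \<Rightarrow> ('a \<Rightarrow> complex) \<Rightarrow> bool" where
  "eigenfunction D c W \<mu> \<phi> \<longleftrightarrow>
     \<phi> \<in> dirichlet_space D \<and> (\<exists>x\<in>D. \<phi> x \<noteq> 0) \<and> (\<forall>x\<in>D. H_op c W \<phi> x = \<mu> * \<phi> x)"

text \<open>The evolution problem is posed in the formal spectral setting: \<open>V t\<close> is, for all times, a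
  combination of finitely many eigenfunctions. The set \<open>F\<close> may depend on the solution but not on
  time, and no regularity in time of the coefficients is prescribed.\<close>

definition finite_mode_path ::
  "'a::euclidean_space set \<Rightarrow> ('a \<Rightarrow> real) \<Rightarrow> ('a \<Rightarrow> real) \<Rightarrow> real \<Rightarrow> (real \<Rightarrow> 'a \<Rightarrow> complex) \<Rightarrow> bool" where
  "finite_mode_path D c W T V \<longleftrightarrow>
     (\<exists>F. finite F \<and> (\<forall>\<phi>\<in>F. \<exists>\<mu>. eigenfunction D c W \<mu> \<phi>) \<and>
        (\<forall>t\<in>{0..T}. \<exists>a. \<forall>x\<in>closure D. V t x = (\<Sum>\<phi>\<in>F. a \<phi> * \<phi> x)))"

definition solves_evolution ::
  "'a::euclidean_space set \<Rightarrow> ('a \<Rightarrow> real) \<Rightarrow> ('a \<Rightarrow> real) \<Rightarrow> real \<Rightarrow> real \<Rightarrow>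
   ('a \<Rightarrow> complex) \<Rightarrow> ('a \<Rightarrow> complex) \<Rightarrow> (real \<Rightarrow> 'a \<Rightarrow> complex) \<Rightarrow> bool" where
  "solves_evolution D c W \<omega> T g v V \<longleftrightarrow>
     finite_mode_path D c W T V \<and>
     (\<forall>x\<in>closure D. continuous_on {0..T} (\<lambda>t. V t x) \<and> V 0 x = v x) \<and>
     (\<forall>t\<in>{0<..<T}. \<forall>x\<in>D.
        (\<lambda>s. V s x) differentiable (at t) \<and>
        vector_derivative (\<lambda>s. V s x) (at t) - \<i> * H_op c W (V t) x
          = \<i> * g x * exp (- \<i> * of_real (\<omega>\<^sup>2 * t)))"

text \<open>Solutions of the evolution problem are unique only up to their values off \<open>closure D\<close> and
  at times outside \<open>[0, T]\<close>, hence \<open>SOME\<close> rather than \<open>THE\<close>.\<close>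

definition G_op ::
  "'a::euclidean_space set \<Rightarrow> ('a \<Rightarrow> real) \<Rightarrow> ('a \<Rightarrow> real) \<Rightarrow> real \<Rightarrow> real \<Rightarrow>
   ('a \<Rightarrow> complex) \<Rightarrow> ('a \<Rightarrow> complex) \<Rightarrow> 'a \<Rightarrow> complex" where
  "G_op D c W \<omega> T g v x =
     of_real (1 / T) *
     integral {0..T} (\<lambda>t. exp (\<i> * of_real (\<omega>\<^sup>2 * t)) * (SOME V. solves_evolution D c W \<omega> T g v V) t x)"

definition solves_helmholtz ::
  "'a::euclidean_space set \<Rightarrow> ('a \<Rightarrow> real) \<Rightarrow> ('a \<Rightarrow> real) \<Rightarrow> real \<Rightarrow> ('a \<Rightarrow> complex) \<Rightarrow> ('a \<Rightarrow> complex) \<Rightarrow> bool" where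
  "solves_helmholtz D c W \<omega> g u \<longleftrightarrow>
     u \<in> dirichlet_space D \<and> (\<forall>x\<in>D. of_real (\<omega>\<^sup>2) * u x + H_op c W u x = - g x)"

end

theory Submission
  imports Defs
begin

text \<open>
  On the mode \<open>\<Phi>\<^sub>k\<close> the evolution equation is the scalar equation
  \<open>a' = \<i> \<lambda>\<^sub>k a + \<i> g\<^sub>k exp (- \<i> \<omega>\<^sup>2 t)\<close>. With \<open>\<mu>\<^sub>k = \<lambda>\<^sub>k + \<omega>\<^sup>2\<close> it has the time-harmonic
  solution \<open>p\<^sub>k exp (- \<i> \<omega>\<^sup>2 t)\<close>, \<open>p\<^sub>k = - g\<^sub>k / \<mu>\<^sub>k\<close>, and every other solution differs from it by a multiple
  of \<open>exp (\<i> \<lambda>\<^sub>k t)\<close>. Filtering with \<open>exp (\<i> \<omega>\<^sup>2 t)\<close> and averaging over \<open>[0, T]\<close> keeps \<open>p\<^sub>k\<close> and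
  multiplies the deviation from it by the mean of \<open>exp (\<i> \<mu>\<^sub>k t)\<close>, the number
  \<open>m\<^sub>k = (exp (\<i> \<mu>\<^sub>k T) - 1) / (\<i> \<mu>\<^sub>k T)\<close>. Starting from zero, the \<open>n\<close>-th iterate is therefore
  \<open>\<Sum>\<^sub>k (1 - m\<^sub>k\<^sup>n) p\<^sub>k \<Phi>\<^sub>k\<close> (lemma \<open>iterate_G_op_modes\<close>).

  Since \<open>Im \<mu>\<^sub>k \<ge> 0\<close>, the number \<open>m\<^sub>k\<close> is a mean of complex numbers in the closed unit disc, and these are
  not all equal when \<open>\<mu>\<^sub>k \<noteq> 0\<close>; hence \<open>\<bar>m\<^sub>k\<bar> < 1\<close> (lemma \<open>norm_mode_factor_less_1\<close>). A mode with \<open>\<mu>\<^sub>k = 0\<close> is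
  not excited, as then \<open>g\<^sub>k = 0\<close>. The iterates converge uniformly to \<open>\<Sum>\<^sub>k p\<^sub>k \<Phi>\<^sub>k\<close>, and \<open>\<mu>\<^sub>k p\<^sub>k = - g\<^sub>k\<close> says
  that this is a solution of the Helmholtz problem.

  The operator \<open>G_op\<close> averages an arbitrarily chosen solution of the evolution problem, so the computation
  above needs uniqueness (lemma \<open>evolution_unique\<close>). The coefficients of a finite-mode path may be
  irregular in time, because its modes may be linearly dependent. The values of the path at suitable
  finitely many points of the domain, on the other hand, are differentiable in time and determine
  the path (lemma \<open>finite_interpolation\<close>); they satisfy a linear system of ordinary differential
  equations, whose solutions are unique by Gronwall's argument (lemma \<open>linear_ode_zero\<close>).
\<close>

section \<open>Linearity of the differential operator\<close>

lemma frechet_derivative_cong_open: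
  assumes "open S" "\<And>y. y \<in> S \<Longrightarrow> f y = g y" "x \<in> S"
  shows "frechet_derivative f (at x) = frechet_derivative g (at x)"
proof -
  have "(f has_derivative f') (at x) \<longleftrightarrow> (g has_derivative f') (at x)" for f'
    using assms has_derivative_transform_within_open[of f f' x UNIV S g]
      has_derivative_transform_within_open[of g f' x UNIV S f] by auto
  then show ?thesis
    unfolding frechet_derivative_def by simp
qed

text \<open>Regularity on an open set ignores the values elsewhere. In particular a derivative of a sum may
  be replaced by the sum of the derivatives, with which it agrees only on that set.\<close>

lemma Ck_on_cong_open:
  assumes "open S" "\<And>y. y \<in> S \<Longrightarrow> f y = g y" "Ck_on k f S"
  shows "Ck_on k g S"
  using assms(2,3)
proof (induction k arbitrary: f g)
  case 0
  then show ?case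
    using continuous_on_cong[of S S f g] by simp
next
  case (Suc k)
  have "frechet_derivative f (at x) = frechet_derivative g (at x)" if "x \<in> S" for x
    using frechet_derivative_cong_open[OF assms(1)] Suc.prems(1) that by blast
  then have "Ck_on k (\<lambda>x. frechet_derivative g (at x) b) S" if "b \<in> Basis" for b
    using Suc.IH[of "\<lambda>x. frechet_derivative f (at x) b" "\<lambda>x. frechet_derivative g (at x) b"]
      Suc.prems(2) that by simp
  moreover have "g differentiable_on S"
    using Suc.prems assms(1) has_derivative_transform_within_open[of f _ _ UNIV S g]
    by (auto simp: differentiable_on_eq_differentiable_at differentiable_def) blast
  ultimately show ?case by simp
qed

lemma frechet_derivative_lincomb:
  fixes f :: "'i \<Rightarrow> 'a::euclidean_space \<Rightarrow> complex"
  assumes "\<And>i. i \<in> I \<Longrightarrow> f i differentiable (at x)"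
  shows "(\<lambda>y. \<Sum>i\<in>I. a i * f i y) differentiable (at x)"
    and "frechet_derivative (\<lambda>y. \<Sum>i\<in>I. a i * f i y) (at x) b
           = (\<Sum>i\<in>I. a i * frechet_derivative (f i) (at x) b)"
proof -
  have "((\<lambda>y. \<Sum>i\<in>I. a i * f i y) has_derivative
          (\<lambda>h. \<Sum>i\<in>I. a i * frechet_derivative (f i) (at x) h)) (at x)"
    using assms by (intro has_derivative_sum has_derivative_mult_right)
      (simp add: frechet_derivative_works)
  then show "(\<lambda>y. \<Sum>i\<in>I. a i * f i y) differentiable (at x)"
    and "frechet_derivative (\<lambda>y. \<Sum>i\<in>I. a i * f i y) (at x) b
           = (\<Sum>i\<in>I. a i * frechet_derivative (f i) (at x) b)"
    by (auto simp: differentiable_def frechet_derivative_at[symmetric])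
qed

lemma Ck_on_lincomb:
  fixes f :: "'i \<Rightarrow> 'a::euclidean_space \<Rightarrow> complex"
  assumes "open S" "\<And>i. i \<in> I \<Longrightarrow> Ck_on k (f i) S"
  shows "Ck_on k (\<lambda>x. \<Sum>i\<in>I. a i * f i x) S"
  using assms(2)
proof (induction k arbitrary: f)
  case 0
  then show ?case by (auto intro!: continuous_intros)
next
  case (Suc k)
  have diff: "f i differentiable (at x)" if "i \<in> I" "x \<in> S" for i x
    using Suc.prems[OF that(1)] that(2) assms(1) by (simp add: differentiable_on_eq_differentiable_at)
  have "Ck_on k (\<lambda>x. frechet_derivative (\<lambda>x. \<Sum>i\<in>I. a i * f i x) (at x) b) S" if "b \<in> Basis" for b
  proof (rule Ck_on_cong_open[OF assms(1)])
    show "Ck_on k (\<lambda>x. \<Sum>i\<in>I. a i * frechet_derivative (f i) (at x) b) S"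
      using Suc.prems that by (intro Suc.IH) simp
  qed (simp add: frechet_derivative_lincomb(2) diff)
  moreover have "(\<lambda>x. \<Sum>i\<in>I. a i * f i x) differentiable_on S"
    using diff assms(1) frechet_derivative_lincomb(1)[of I f]
    by (simp add: differentiable_on_eq_differentiable_at)
  ultimately show ?case by simp
qed

text \<open>The function \<open>u\<close> is kept apart from the sum because it will be a time slice of an evolution,
  which equals a combination of given functions only on the domain.\<close>

lemma H_op_lincomb:
  fixes f :: "'i \<Rightarrow> 'a::euclidean_space \<Rightarrow> complex"
  assumes "open D" "\<And>i. i \<in> I \<Longrightarrow> Ck_on 2 (f i) D" "x \<in> D"
    and eq: "\<And>y. y \<in> D \<Longrightarrow> u y = (\<Sum>i\<in>I. a i * f i y)"
  shows "H_op c W u x = (\<Sum>i\<in>I. a i * H_op c W (f i) x)"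
proof -
  have diff1: "f i differentiable (at y)" if "i \<in> I" "y \<in> D" for i y
    using assms(2)[OF that(1)] that(2) assms(1)
    by (simp add: numeral_2_eq_2 differentiable_on_eq_differentiable_at)
  have diff2: "(\<lambda>z. frechet_derivative (f i) (at z) b) differentiable (at y)"
    if "i \<in> I" "y \<in> D" "b \<in> Basis" for i y b
    using assms(2)[OF that(1)] that(2,3) assms(1)
    by (simp add: numeral_2_eq_2 differentiable_on_eq_differentiable_at)
  have D1: "frechet_derivative u (at y) b = (\<Sum>i\<in>I. a i * frechet_derivative (f i) (at y) b)"
    if "y \<in> D" for y b
    using frechet_derivative_cong_open[of D u _ y, OF assms(1) eq that] frechet_derivative_lincomb(2)[of I f y a b]
      diff1 that by simp
  have "frechet_derivative (\<lambda>y. frechet_derivative u (at y) b) (at x) b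
          = (\<Sum>i\<in>I. a i * frechet_derivative (\<lambda>y. frechet_derivative (f i) (at y) b) (at x) b)"
    if "b \<in> Basis" for b
    using frechet_derivative_cong_open[of D "\<lambda>y. frechet_derivative u (at y) b" _ x, OF assms(1) D1 assms(3)]
      frechet_derivative_lincomb(2)[of I "\<lambda>i y. frechet_derivative (f i) (at y) b" x a b]
      diff2 assms(3) that by simp
  then have "laplacian u x = (\<Sum>i\<in>I. a i * laplacian (f i) x)"
    unfolding laplacian_def sum_distrib_left by (subst sum.swap) (rule sum.cong, simp_all)
  then show ?thesis
    unfolding H_op_def by (simp add: eq[OF assms(3)] sum_distrib_left sum.distrib distrib_left mult_ac)
qed

lemma dirichlet_space_lincomb:
  assumes "open D" "\<And>i. i \<in> I \<Longrightarrow> f i \<in> dirichlet_space D"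
  shows "(\<lambda>x. \<Sum>i\<in>I. a i * f i x) \<in> dirichlet_space D"
  using assms Ck_on_lincomb[of D I 2 f a]
  by (auto simp: dirichlet_space_def intro!: continuous_intros)

section \<open>Uniqueness for the evolution problem\<close>

text \<open>Every function in a finite-dimensional space is recovered from its values at finitely many
  points. One function \<open>\<phi>\<close> is added at a time: if its interpolation error \<open>r\<close> is not zero,
  a point \<open>q\<close> with \<open>r q \<noteq> 0\<close> becomes a further node, and the multiple of \<open>r\<close> that
  corrects the value at \<open>q\<close> is added to the old interpolant. The set \<open>S\<close>, any linear space
  containing the functions, carries regularity over to the interpolating functions \<open>w\<close>.\<close>

lemma finite_interpolation:
  fixes F S :: "('a \<Rightarrow> complex) set" and D :: "'a set"
  assumes "finite F" "F \<subseteq> S"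
    and zero: "(\<lambda>x. 0) \<in> S"
    and lin: "\<And>f g c. f \<in> S \<Longrightarrow> g \<in> S \<Longrightarrow> (\<lambda>x. f x + c * g x) \<in> S"
  shows "\<exists>P w. finite P \<and> P \<subseteq> D \<and> (\<forall>p. w p \<in> S) \<and>
           (\<forall>f\<in>F. \<forall>x\<in>D. f x = (\<Sum>p\<in>P. f p * w p x))"
  using assms(1,2)
proof (induction F rule: finite_induct)
  case empty
  then show ?case using zero by auto
next
  case (insert \<phi> F)
  then obtain P w where P: "finite P" "P \<subseteq> D" and w: "\<And>p. w p \<in> S"
    and rep: "\<And>f x. f \<in> F \<Longrightarrow> x \<in> D \<Longrightarrow> f x = (\<Sum>p\<in>P. f p * w p x)" by fastforce
  define r where "r x = \<phi> x - (\<Sum>p\<in>P. \<phi> p * w p x)" for x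
  have "(\<lambda>x. \<phi> x + (- 1) * (\<Sum>p\<in>P. \<phi> p * w p x)) \<in> S"
  proof -
    have "(\<lambda>x. \<Sum>p\<in>Q. \<phi> p * w p x) \<in> S" if "finite Q" for Q
      using that
    proof (induction Q rule: finite_induct)
      case (insert q Q)
      then show ?case using lin[OF insert.IH w, of "\<phi> q"] by (simp add: add.commute)
    qed (simp add: zero)
    then show ?thesis using lin[of \<phi> _ "- 1"] insert.prems P(1) by blast
  qed
  then have r: "r \<in> S" by (simp add: r_def[abs_def])
  show ?case
  proof (cases "\<forall>x\<in>D. r x = 0")
    case True
    then show ?thesis
      using P w rep by (intro exI[of _ P] exI[of _ w]) (auto simp: r_def)
  next
    case False
    then obtain q where q: "q \<in> D" "r q \<noteq> 0" by blast
    \<comment> \<open>Weights outside \<open>P\<close> are set to zero, so that one formula gives the new weights whether or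
      not \<open>q\<close> is already a node.\<close>
    define w0 where "w0 p = (if p \<in> P then w p else (\<lambda>x. 0))" for p
    define d where "d p = ((if p = q then 1 else 0) - w0 p q) / r q" for p
    define w' where "w' p = (\<lambda>x. w0 p x + d p * r x)" for p
    have sum0: "(\<Sum>p\<in>insert q P. f p * w0 p x) = (\<Sum>p\<in>P. f p * w p x)" for f x
      using P(1) by (cases "q \<in> P") (auto simp: w0_def insert_absorb intro: sum.cong)
    have "(\<Sum>p\<in>insert q P. f p * d p) = (f q - (\<Sum>p\<in>P. f p * w p q)) / r q" for f
    proof -
      have "(\<Sum>p\<in>insert q P. f p * d p)
          = ((\<Sum>p\<in>insert q P. if p = q then f p else 0) - (\<Sum>p\<in>insert q P. f p * w0 p q)) / r q"
        unfolding d_def sum_subtractf[symmetric] sum_divide_distrib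
        by (intro sum.cong) (auto simp: field_simps q)
      then show ?thesis using P(1) by (simp only: sum0) simp
    qed
    then have sum': "(\<Sum>p\<in>insert q P. f p * w' p x)
        = (\<Sum>p\<in>P. f p * w p x) + (f q - (\<Sum>p\<in>P. f p * w p q)) / r q * r x" for f x
      by (simp add: w'_def distrib_left sum.distrib sum0 mult.assoc[symmetric] sum_distrib_right[symmetric]
          del: sum.insert sum.insert_if)
    have "f x = (\<Sum>p\<in>insert q P. f p * w' p x)" if "f \<in> insert \<phi> F" "x \<in> D" for f x
    proof (cases "f = \<phi>")
      case True
      then show ?thesis using q unfolding sum' by (simp add: r_def)
    next
      case False
      then show ?thesis using that q rep[of f] unfolding sum' by simp
    qed
    moreover have "w' p \<in> S" for p
      unfolding w'_def w0_def using w zero r lin by simp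
    ultimately show ?thesis
      using P q by (intro exI[of _ "insert q P"] exI[of _ w']) auto
  qed
qed

text \<open>Gronwall's argument: the squared norm \<open>N\<close> satisfies \<open>N' \<le> C N\<close>, so \<open>exp (- C t) N\<close> decreases
  from its initial value zero.\<close>

lemma linear_ode_zero:
  fixes y :: "'i \<Rightarrow> real \<Rightarrow> complex" and A :: "'i \<Rightarrow> 'i \<Rightarrow> complex"
  assumes "finite P"
    and cont: "\<And>p. p \<in> P \<Longrightarrow> continuous_on {0..T} (y p)"
    and init: "\<And>p. p \<in> P \<Longrightarrow> y p 0 = 0"
    and ode: "\<And>p t. p \<in> P \<Longrightarrow> 0 < t \<Longrightarrow> t < T \<Longrightarrow>
                (y p has_vector_derivative (\<Sum>q\<in>P. A p q * y q t)) (at t)"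
    and "p \<in> P" "t \<in> {0..T}"
  shows "y p t = 0"
proof -
  define N where "N t = (\<Sum>p\<in>P. y p t \<bullet> y p t)" for t
  define N' where "N' t = (\<Sum>p\<in>P. 2 * (y p t \<bullet> (\<Sum>q\<in>P. A p q * y q t)))" for t
  define C where "C = 2 * (\<Sum>p\<in>P. \<Sum>q\<in>P. cmod (A p q))"
  have le_N: "(cmod (y p t))\<^sup>2 \<le> N t" if "p \<in> P" for p t
    unfolding N_def dot_square_norm using that \<open>finite P\<close>
    by (intro member_le_sum) auto
  have bound: "N' t \<le> C * N t" for t
  proof -
    have "2 * (y p t \<bullet> (A p q * y q t)) \<le> cmod (A p q) * (2 * N t)" if "p \<in> P" "q \<in> P" for p q
    proof -
      have "2 * (y p t \<bullet> (A p q * y q t)) \<le> 2 * (cmod (y p t) * cmod (A p q * y q t))"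
        using norm_cauchy_schwarz[of "y p t" "A p q * y q t"] by simp
      also have "\<dots> = cmod (A p q) * (2 * cmod (y p t) * cmod (y q t))"
        by (simp add: norm_mult)
      also have "\<dots> \<le> cmod (A p q) * ((cmod (y p t))\<^sup>2 + (cmod (y q t))\<^sup>2)"
        by (intro mult_left_mono sum_squares_bound) simp
      also have "\<dots> \<le> cmod (A p q) * (2 * N t)"
        using le_N[OF that(1), of t] le_N[OF that(2), of t] by (intro mult_left_mono) auto
      finally show ?thesis .
    qed
    then have "N' t \<le> (\<Sum>p\<in>P. \<Sum>q\<in>P. cmod (A p q) * (2 * N t))"
      unfolding N'_def inner_sum_right sum_distrib_left by (intro sum_mono)
    also have "\<dots> = C * N t"
      by (simp add: C_def sum_distrib_right[symmetric])
    finally show ?thesis .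
  qed
  have dN: "(N has_real_derivative N' s) (at s)" if "0 < s" "s < T" for s
  proof -
    have "((\<lambda>s. y p s \<bullet> y p s) has_real_derivative 2 * (y p s \<bullet> (\<Sum>q\<in>P. A p q * y q s))) (at s)"
      if "p \<in> P" for p
      using has_derivative_inner[OF ode[OF that \<open>0 < s\<close> \<open>s < T\<close>, unfolded has_vector_derivative_def]
          ode[OF that \<open>0 < s\<close> \<open>s < T\<close>, unfolded has_vector_derivative_def]]
      by (rule has_derivative_imp_has_field_derivative) (simp add: inner_commute)
    then show ?thesis
      unfolding N_def[abs_def] N'_def by (rule DERIV_sum)
  qed
  have "exp (- C * t) * N t \<le> exp (- C * 0) * N 0"
  proof (rule DERIV_nonpos_imp_decreasing_open[of 0 t "\<lambda>s. exp (- C * s) * N s"])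
    show "continuous_on {0..t} (\<lambda>s. exp (- C * s) * N s)"
      unfolding N_def using assms(6)
      by (auto intro!: continuous_intros continuous_on_subset[OF cont])
    fix s assume s: "0 < s" "s < t"
    have "((\<lambda>s. exp (- C * s) * N s) has_real_derivative exp (- C * s) * (N' s - C * N s)) (at s)"
      using s assms(6) by (auto intro!: derivative_eq_intros dN simp: algebra_simps)
    moreover have "exp (- C * s) * (N' s - C * N s) \<le> 0"
      using bound[of s] by (simp add: mult_nonneg_nonpos)
    ultimately show "\<exists>z. ((\<lambda>s. exp (- C * s) * N s) has_real_derivative z) (at s) \<and> z \<le> 0" by blast
  qed (use assms(6) in simp)
  then have "N t \<le> 0"
    by (simp add: N_def init mult_le_0_iff)
  then have "(cmod (y p t))\<^sup>2 \<le> 0"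
    using le_N[OF assms(5), of t] by linarith
  then show ?thesis by simp
qed

lemma finite_mode_path_dirichlet:
  assumes "finite_mode_path D c W T V"
  obtains F where "finite F" "F \<subseteq> dirichlet_space D"
    "\<And>t. t \<in> {0..T} \<Longrightarrow> \<exists>a. \<forall>x\<in>closure D. V t x = (\<Sum>\<phi>\<in>F. a \<phi> * \<phi> x)"
proof -
  obtain F where "finite F" "\<forall>\<phi>\<in>F. \<exists>\<mu>. eigenfunction D c W \<mu> \<phi>"
    "\<forall>t\<in>{0..T}. \<exists>a. \<forall>x\<in>closure D. V t x = (\<Sum>\<phi>\<in>F. a \<phi> * \<phi> x)"
    using assms unfolding finite_mode_path_def by (elim exE conjE)
  moreover from this(2) have "F \<subseteq> dirichlet_space D"
    by (auto simp: eigenfunction_def)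
  ultimately show ?thesis
    by (intro that[of F]) simp_all
qed

text \<open>Both solutions take values in the span of finitely many functions, so they are determined on the
  domain by their values at interpolation nodes. Applying the operator to the interpolation formula
  expresses it, too, through the nodal values; the nodal values of the difference of the two
  solutions thus solve a homogeneous linear system with zero initial data. On the boundary all modes
  vanish.\<close>

lemma evolution_unique:
  fixes D :: "'a::euclidean_space set"
  assumes "open D"
    and "solves_evolution D c W \<omega> T g v V1" "solves_evolution D c W \<omega> T g v V2"
    and t: "t \<in> {0..T}" and x: "x \<in> closure D"
  shows "V1 t x = V2 t x"
proof -
  obtain F1 where F1: "finite F1" "F1 \<subseteq> dirichlet_space D"
    "\<And>t. t \<in> {0..T} \<Longrightarrow> \<exists>a. \<forall>x\<in>closure D. V1 t x = (\<Sum>\<phi>\<in>F1. a \<phi> * \<phi> x)"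
    by (rule finite_mode_path_dirichlet[OF assms(2)[unfolded solves_evolution_def, THEN conjunct1]]) (rule that)
  obtain F2 where F2: "finite F2" "F2 \<subseteq> dirichlet_space D"
    "\<And>t. t \<in> {0..T} \<Longrightarrow> \<exists>a. \<forall>x\<in>closure D. V2 t x = (\<Sum>\<phi>\<in>F2. a \<phi> * \<phi> x)"
    by (rule finite_mode_path_dirichlet[OF assms(3)[unfolded solves_evolution_def, THEN conjunct1]]) (rule that)
  have "\<exists>P w. finite P \<and> P \<subseteq> D \<and> (\<forall>p. w p \<in> {u. Ck_on 2 u D}) \<and>
          (\<forall>f\<in>F1 \<union> F2. \<forall>x\<in>D. f x = (\<Sum>p\<in>P. f p * w p x))"
  proof (rule finite_interpolation)
    show "(\<lambda>x. f x + k * h x) \<in> {u. Ck_on 2 u D}"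
      if "f \<in> {u. Ck_on 2 u D}" "h \<in> {u. Ck_on 2 u D}" for f h :: "'a \<Rightarrow> complex" and k
      using Ck_on_lincomb[OF \<open>open D\<close>, of "UNIV::bool set" 2 "\<lambda>b. if b then f else h" "\<lambda>b. if b then 1 else k"] that
      by (simp add: UNIV_bool add.commute)
    show "(\<lambda>x::'a. 0::complex) \<in> {u. Ck_on 2 u D}"
      using Ck_on_lincomb[OF \<open>open D\<close>, of "{}::nat set" 2] by simp
  qed (use F1 F2 in \<open>auto simp: dirichlet_space_def\<close>)
  then obtain P w where P: "finite P" "P \<subseteq> D"
    and w_all: "\<forall>p. w p \<in> {u. Ck_on 2 u D}"
    and rep_all: "\<forall>f\<in>F1 \<union> F2. \<forall>x\<in>D. f x = (\<Sum>p\<in>P. f p * w p x)"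
    by (elim exE conjE) (rule that)
  have w: "Ck_on 2 (w p) D" for p
    using w_all by blast
  have rep: "f x = (\<Sum>p\<in>P. f p * w p x)" if "f \<in> F1 \<union> F2" "x \<in> D" for f x
    using rep_all that by (elim ballE) auto
  have cl: "D \<subseteq> closure D" by (rule closure_subset)
  \<comment> \<open>The interpolation formula extends linearly to the span of the modes.\<close>
  have rep_span: "u x = (\<Sum>p\<in>P. u p * w p x)"
    if F: "F \<subseteq> F1 \<union> F2" and u: "\<And>x. x \<in> closure D \<Longrightarrow> u x = (\<Sum>\<phi>\<in>F. a \<phi> * \<phi> x)" and x: "x \<in> D"
    for F u a x
  proof -
    have "u x = (\<Sum>\<phi>\<in>F. a \<phi> * \<phi> x)"
      using u x cl by blast
    also have "\<dots> = (\<Sum>\<phi>\<in>F. a \<phi> * (\<Sum>p\<in>P. \<phi> p * w p x))"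
    proof (rule sum.cong[OF refl])
      fix \<phi> assume "\<phi> \<in> F"
      then have "\<phi> \<in> F1 \<union> F2" using F by blast
      from rep[OF this x] show "a \<phi> * \<phi> x = a \<phi> * (\<Sum>p\<in>P. \<phi> p * w p x)"
        by (rule arg_cong)
    qed
    also have "\<dots> = (\<Sum>p\<in>P. (\<Sum>\<phi>\<in>F. a \<phi> * \<phi> p) * w p x)"
      unfolding sum_distrib_left sum_distrib_right by (subst sum.swap) (simp only: mult.assoc)
    also have "\<dots> = (\<Sum>p\<in>P. u p * w p x)"
    proof (rule sum.cong[OF refl])
      fix p assume "p \<in> P"
      then have "p \<in> closure D" using P(2) cl by blast
      then show "(\<Sum>\<phi>\<in>F. a \<phi> * \<phi> p) * w p x = u p * w p x"
        by (simp only: u)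
    qed
    finally show ?thesis .
  qed
  have rep1: "V1 s z = (\<Sum>p\<in>P. V1 s p * w p z)" if s: "s \<in> {0..T}" and z: "z \<in> D" for s z
  proof -
    obtain a where "\<forall>x\<in>closure D. V1 s x = (\<Sum>\<phi>\<in>F1. a \<phi> * \<phi> x)"
      using F1(3)[OF s] by (rule exE)
    then show ?thesis
      by (intro rep_span[of F1 _ a, OF Un_upper1 _ z]) (rule bspec)
  qed
  have rep2: "V2 s z = (\<Sum>p\<in>P. V2 s p * w p z)" if s: "s \<in> {0..T}" and z: "z \<in> D" for s z
  proof -
    obtain a where "\<forall>x\<in>closure D. V2 s x = (\<Sum>\<phi>\<in>F2. a \<phi> * \<phi> x)"
      using F2(3)[OF s] by (rule exE)
    then show ?thesis
      by (intro rep_span[of F2 _ a, OF Un_upper2 _ z]) (rule bspec)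
  qed
  define y where "y p s = V1 s p - V2 s p" for p s
  define A where "A p q = \<i> * H_op c W (w q) p" for p q
  have y0: "y p t = 0" if "p \<in> P" for p
  proof (rule linear_ode_zero[OF P(1) _ _ _ that t, where A = A])
    fix p assume p: "p \<in> P"
    then have pD: "p \<in> D" "p \<in> closure D" using P closure_subset by auto
    show "continuous_on {0..T} (y p)"
      unfolding y_def using assms(2,3) pD by (auto simp: solves_evolution_def intro!: continuous_intros)
    show "y p 0 = 0"
      unfolding y_def using assms(2,3) pD by (auto simp: solves_evolution_def)
    fix s assume s: "0 < s" "s < T"
    let ?e = "\<i> * g p * exp (- \<i> * of_real (\<omega>\<^sup>2 * s))"
    have der: "((\<lambda>s. V s p) has_vector_derivative (\<i> * (\<Sum>q\<in>P. V s q * H_op c W (w q) p) + ?e)) (at s)"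
      if "solves_evolution D c W \<omega> T g v V" "\<And>z. z \<in> D \<Longrightarrow> V s z = (\<Sum>q\<in>P. V s q * w q z)" for V
    proof -
      have "(\<lambda>s. V s p) differentiable (at s)"
        and "vector_derivative (\<lambda>s. V s p) (at s) = \<i> * H_op c W (V s) p + ?e"
        using that(1) s pD by (auto simp: solves_evolution_def algebra_simps)
      moreover have "H_op c W (V s) p = (\<Sum>q\<in>P. V s q * H_op c W (w q) p)"
        by (rule H_op_lincomb[OF \<open>open D\<close> w pD(1) that(2)])
      ultimately show ?thesis by (simp add: vector_derivative_works)
    qed
    have "(y p has_vector_derivative
        (\<i> * (\<Sum>q\<in>P. V1 s q * H_op c W (w q) p) + ?e) - (\<i> * (\<Sum>q\<in>P. V2 s q * H_op c W (w q) p) + ?e)) (at s)"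
      unfolding y_def[abs_def] using s
      by (intro has_vector_derivative_diff der assms(2,3) rep1 rep2) auto
    then show "(y p has_vector_derivative (\<Sum>q\<in>P. A p q * y q s)) (at s)"
      by (simp add: A_def y_def algebra_simps sum_distrib_left sum_subtractf)
  qed
  show ?thesis
  proof (cases "x \<in> D")
    case True
    then show ?thesis
      using rep1[OF t True] rep2[OF t True] y0 by (simp add: y_def)
  next
    case False
    then have "x \<in> frontier D" using x \<open>open D\<close> by (simp add: frontier_def interior_open)
    then have zero: "\<phi> x = 0" if "\<phi> \<in> dirichlet_space D" for \<phi>
      using that by (simp add: dirichlet_space_def)
    have "V1 t x = 0"
      using F1(3)[OF t] F1(2) x zero by (metis (no_types, lifting) mult_zero_right subsetD sum.neutral)
    moreover have "V2 t x = 0"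
      using F2(3)[OF t] F2(2) x zero by (metis (no_types, lifting) mult_zero_right subsetD sum.neutral)
    ultimately show ?thesis by simp
  qed
qed

section \<open>The averaging factor of a single mode\<close>

text \<open>The duplication formula turns the weak bound at \<open>h / 2\<close> into a strict one at \<open>h\<close>: a factor
  \<open>\<bar>cos (h / 2)\<bar>\<close> is gained, which is less than \<open>1\<close> unless \<open>sin h\<close> vanishes.\<close>

lemma abs_sin_less_abs:
  fixes h :: real
  assumes "h \<noteq> 0"
  shows "\<bar>sin h\<bar> < \<bar>h\<bar>"
proof -
  define k where "k = h / 2"
  have eq: "\<bar>sin h\<bar> = 2 * \<bar>sin k\<bar> * \<bar>cos k\<bar>"
    using sin_double[of k] by (simp add: k_def abs_mult)
  show ?thesis
  proof (cases "\<bar>cos k\<bar> = 1")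
    case True
    then have "sin k = 0" using sin_cos_squared_add[of k] power2_abs[of "cos k"]
      by (simp del: power2_abs sin_cos_squared_add)
    then show ?thesis using eq assms by simp
  next
    case False
    then have "\<bar>cos k\<bar> < 1" using abs_cos_le_one[of k] by linarith
    then have "\<bar>k\<bar> * \<bar>cos k\<bar> < \<bar>k\<bar> * 1" using assms by (intro mult_strict_left_mono) (auto simp: k_def)
    moreover have "\<bar>sin k\<bar> * \<bar>cos k\<bar> \<le> \<bar>k\<bar> * \<bar>cos k\<bar>"
      by (intro mult_right_mono abs_sin_x_le_abs_x) simp
    ultimately show ?thesis unfolding eq by (simp add: k_def)
  qed
qed

text \<open>For \<open>z = x + \<i> y\<close> one has \<open>\<bar>exp z - 1\<bar>\<^sup>2 = (1 - exp x)\<^sup>2 + exp x (2 sin (y / 2))\<^sup>2\<close>. For \<open>x \<le> 0\<close>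
  the two terms are at most \<open>x\<^sup>2\<close> and \<open>y\<^sup>2\<close>; the first bound is strict if \<open>x \<noteq> 0\<close>, and
  the second one if \<open>x = 0\<close> and \<open>y \<noteq> 0\<close>.\<close>

lemma norm_exp_minus_one_less:
  fixes z :: complex
  assumes "Re z \<le> 0" "z \<noteq> 0"
  shows "cmod (exp z - 1) < cmod z"
proof -
  define x y where "x = Re z" and "y = Im z"
  have cosy: "cos y = 1 - 2 * (sin (y / 2))\<^sup>2"
    using cos_double_sin[of "y/2"] by simp
  have "(cmod (exp z - 1))\<^sup>2 = (exp x * cos y - 1)\<^sup>2 + (exp x * sin y)\<^sup>2"
    by (simp add: cmod_power2 Re_exp Im_exp x_def y_def)
  also have "\<dots> = (exp x)\<^sup>2 * ((sin y)\<^sup>2 + (cos y)\<^sup>2) - 2 * exp x * cos y + 1"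
    by algebra
  also have "\<dots> = (1 - exp x)\<^sup>2 + exp x * (2 * sin (y / 2))\<^sup>2"
    unfolding sin_cos_squared_add by (simp add: cosy power2_eq_square algebra_simps)
  finally have eq: "(cmod (exp z - 1))\<^sup>2 = (1 - exp x)\<^sup>2 + exp x * (2 * sin (y / 2))\<^sup>2" .
  have xle: "x \<le> 0" using assms by (simp add: x_def)
  have s: "(2 * sin (y / 2))\<^sup>2 \<le> y\<^sup>2"
    using abs_sin_x_le_abs_x[of "y/2"] by (intro abs_le_square_iff[THEN iffD1]) (simp add: abs_mult)
  have "(1 - exp x)\<^sup>2 + exp x * (2 * sin (y / 2))\<^sup>2 < x\<^sup>2 + y\<^sup>2"
  proof (cases "x = 0")
    case True
    then have "y \<noteq> 0" using assms x_def y_def complex_eq_iff by auto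
    then have "\<bar>2 * sin (y / 2)\<bar> < \<bar>y\<bar>"
      using abs_sin_less_abs[of "y / 2"] by (simp add: abs_mult)
    then have "(2 * sin (y / 2))\<^sup>2 < y\<^sup>2"
      using power_strict_mono[of "\<bar>2 * sin (y / 2)\<bar>" "\<bar>y\<bar>" 2]
      by (simp only: power2_abs abs_ge_zero)
    then show ?thesis using True by simp
  next
    case False
    have "exp x \<noteq> 1 + x"
    proof
      assume "exp x = 1 + x"
      then have "ln (exp x) = exp x - 1" unfolding ln_exp by simp
      then show False using ln_eq_minus_one[OF exp_gt_zero] False by fastforce
    qed
    then have "1 - exp x < - x"
      using exp_ge_add_one_self[of x] by linarith
    then have "(1 - exp x)\<^sup>2 < (- x)\<^sup>2"
      using xle by (intro power_strict_mono) auto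
    moreover have "exp x * (2 * sin (y / 2))\<^sup>2 \<le> 1 * y\<^sup>2"
      using s xle by (intro mult_mono) auto
    ultimately show ?thesis by simp
  qed
  also have "\<dots> = (cmod z)\<^sup>2" by (simp add: cmod_power2 x_def y_def)
  finally show ?thesis
    unfolding eq[symmetric] by (rule power_less_imp_less_base) simp
qed

text \<open>The mean of \<open>exp (\<i> \<mu> t)\<close> over \<open>[0, T]\<close>; the value at \<open>\<mu> = 0\<close> keeps this true there.\<close>

definition mode_factor :: "real \<Rightarrow> complex \<Rightarrow> complex" where
  "mode_factor T \<mu> = (if \<mu> = 0 then 1 else (exp (\<i> * \<mu> * T) - 1) / (\<i> * \<mu> * T))"

lemma norm_mode_factor_less_1:
  assumes "T > 0" "\<mu> \<noteq> 0" "Im \<mu> \<ge> 0"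
  shows "cmod (mode_factor T \<mu>) < 1"
  using assms norm_exp_minus_one_less[of "\<i> * \<mu> * T"]
  by (simp add: mode_factor_def norm_divide divide_less_eq)

lemma has_integral_exp_mode:
  assumes "T > 0"
  shows "((\<lambda>t. exp (\<i> * \<mu> * of_real t)) has_integral of_real T * mode_factor T \<mu>) {0..T}"
proof (cases "\<mu> = 0")
  case True
  then show ?thesis
    using has_integral_const_real[of "1::complex" 0 T] assms by (simp add: mode_factor_def scaleR_conv_of_real)
next
  case False
  have "((\<lambda>t. exp (\<i> * \<mu> * of_real t)) has_integral
      exp (\<i> * \<mu> * of_real T) / (\<i> * \<mu>) - exp (\<i> * \<mu> * of_real 0) / (\<i> * \<mu>)) {0..T}"
    using assms False
    by (intro fundamental_theorem_of_calculus)
      (auto intro!: derivative_eq_intros has_vector_derivative_real_field simp: field_simps)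
  moreover have "exp (\<i> * \<mu> * of_real T) / (\<i> * \<mu>) - exp (\<i> * \<mu> * of_real 0) / (\<i> * \<mu>)
      = of_real T * mode_factor T \<mu>"
    using False assms by (simp add: mode_factor_def divide_simps)
  ultimately show ?thesis by simp
qed

section \<open>The fixed-point operator in eigenmode coordinates\<close>

text \<open>The number \<open>p\<close> is the amplitude of the time-harmonic solution and \<open>a\<close> is the initial value.\<close>

definition mode_solution :: "complex \<Rightarrow> real \<Rightarrow> complex \<Rightarrow> complex \<Rightarrow> real \<Rightarrow> complex" where
  "mode_solution \<nu> \<omega> p a t =
     (a - p) * exp (\<i> * \<nu> * of_real t) + p * exp (- \<i> * of_real (\<omega>\<^sup>2 * t))"

text \<open>The condition on \<open>p\<close> is written as a product, so that it also covers a resonant mode that is not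
  excited, \<open>\<nu> + \<omega>\<^sup>2 = 0\<close> and \<open>b = 0\<close>.\<close>

lemma mode_solution_deriv:
  assumes "(\<nu> + of_real (\<omega>\<^sup>2)) * p = - b"
  shows "(mode_solution \<nu> \<omega> p a has_vector_derivative
           \<i> * (\<nu> * mode_solution \<nu> \<omega> p a t) + \<i> * b * exp (- \<i> * of_real (\<omega>\<^sup>2 * t))) (at t)"
proof -
  have b: "b = - ((\<nu> + of_real (\<omega>\<^sup>2)) * p)" using assms by simp
  have "((\<lambda>t. (a - p) * exp (\<i> * \<nu> * of_real t) + p * exp (- \<i> * (of_real (\<omega>\<^sup>2) * of_real t)))
      has_vector_derivative
        (a - p) * (exp (\<i> * \<nu> * of_real t) * (\<i> * \<nu>))
          + p * (exp (- \<i> * (of_real (\<omega>\<^sup>2) * of_real t)) * (- \<i> * of_real (\<omega>\<^sup>2)))) (at t)"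
    by (auto intro!: derivative_eq_intros has_vector_derivative_real_field)
  then show ?thesis
    unfolding mode_solution_def[abs_def] b of_real_mult
    by (rule has_vector_derivative_eq_rhs) (simp add: algebra_simps)
qed

lemma has_integral_mode_solution:
  assumes "T > 0"
  shows "((\<lambda>t. exp (\<i> * of_real (\<omega>\<^sup>2 * t)) * mode_solution \<nu> \<omega> p a t) has_integral
           of_real T * (p + mode_factor T (\<nu> + of_real (\<omega>\<^sup>2)) * (a - p))) {0..T}"
proof -
  have "((\<lambda>t. p + (a - p) * exp (\<i> * (\<nu> + of_real (\<omega>\<^sup>2)) * of_real t)) has_integral
      of_real T * p + (a - p) * (of_real T * mode_factor T (\<nu> + of_real (\<omega>\<^sup>2)))) {0..T}"
    using has_integral_const_real[of p 0 T] assms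
    by (intro has_integral_add has_integral_mult_right has_integral_exp_mode)
      (simp_all add: scaleR_conv_of_real)
  moreover have "exp (\<i> * of_real (\<omega>\<^sup>2 * t)) * mode_solution \<nu> \<omega> p a t
      = p + (a - p) * exp (\<i> * (\<nu> + of_real (\<omega>\<^sup>2)) * of_real t)" for t
    by (simp add: mode_solution_def distrib_left distrib_right exp_add[symmetric] exp_minus field_simps)
  moreover have "of_real T * p + (a - p) * (of_real T * mode_factor T (\<nu> + of_real (\<omega>\<^sup>2)))
      = of_real T * (p + mode_factor T (\<nu> + of_real (\<omega>\<^sup>2)) * (a - p))"
    by algebra
  ultimately show ?thesis by simp
qed

text \<open>The functions \<open>\<Phi> k\<close> need not be distinct, whereas a finite-mode path is a combination over a set of
  functions; equal modes have to be collected.\<close>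

lemma sum_over_image:
  fixes \<Phi> :: "'k \<Rightarrow> 'a \<Rightarrow> complex"
  assumes "finite K"
  shows "(\<Sum>k\<in>K. a k * \<Phi> k x) = (\<Sum>\<phi>\<in>\<Phi> ` K. (\<Sum>k\<in>{k \<in> K. \<Phi> k = \<phi>}. a k) * \<phi> x)"
  unfolding sum_distrib_right
  by (rule trans[OF sum.image_gen[OF assms, of _ \<Phi>]], intro sum.cong) auto

lemma solves_evolution_modes:
  fixes \<Phi> :: "'k \<Rightarrow> 'a::euclidean_space \<Rightarrow> complex"
  assumes "open D" "T > 0" "finite K"
    and eig: "\<And>k. k \<in> K \<Longrightarrow> eigenfunction D c W (ev k) (\<Phi> k)"
    and g: "\<And>x. x \<in> D \<Longrightarrow> g x = (\<Sum>k\<in>K. gc k * \<Phi> k x)"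
    and p: "\<And>k. k \<in> K \<Longrightarrow> (ev k + of_real (\<omega>\<^sup>2)) * p k = - gc k"
    and v: "\<And>x. x \<in> closure D \<Longrightarrow> v x = (\<Sum>k\<in>K. a k * \<Phi> k x)"
  shows "solves_evolution D c W \<omega> T g v
           (\<lambda>t x. \<Sum>k\<in>K. mode_solution (ev k) \<omega> (p k) (a k) t * \<Phi> k x)"
    (is "solves_evolution _ _ _ _ _ _ _ ?V")
  unfolding solves_evolution_def
proof (intro conjI ballI)
  have "\<forall>x\<in>closure D. ?V t x
      = (\<Sum>\<phi>\<in>\<Phi> ` K. (\<Sum>k\<in>{k \<in> K. \<Phi> k = \<phi>}. mode_solution (ev k) \<omega> (p k) (a k) t) * \<phi> x)" for t
    by (intro ballI sum_over_image[OF \<open>finite K\<close>])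
  then have "\<exists>b. \<forall>x\<in>closure D. ?V t x = (\<Sum>\<phi>\<in>\<Phi> ` K. b \<phi> * \<phi> x)" for t
    by fast
  then show "finite_mode_path D c W T ?V"
    unfolding finite_mode_path_def using assms(3) eig
    by (intro exI[of _ "\<Phi> ` K"]) blast
next
  fix x assume x: "x \<in> closure D"
  show "continuous_on {0..T} (\<lambda>t. ?V t x)"
    unfolding mode_solution_def by (intro continuous_intros)
  show "?V 0 x = v x"
    by (simp add: v[OF x] mode_solution_def)
next
  fix t x assume t: "t \<in> {0<..<T}" and x: "x \<in> D"
  let ?e = "exp (- \<i> * of_real (\<omega>\<^sup>2 * t))"
  let ?m = "\<lambda>k. mode_solution (ev k) \<omega> (p k) (a k) t"
  have der: "((\<lambda>s. ?V s x) has_vector_derivative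
      (\<Sum>k\<in>K. (\<i> * (ev k * ?m k) + \<i> * gc k * ?e) * \<Phi> k x)) (at t)"
    by (intro has_vector_derivative_sum has_vector_derivative_mult_left mode_solution_deriv p)
  have "H_op c W (?V t) x = (\<Sum>k\<in>K. ?m k * H_op c W (\<Phi> k) x)"
    using eig x by (intro H_op_lincomb[OF \<open>open D\<close>]) (auto simp: eigenfunction_def dirichlet_space_def)
  also have "\<dots> = (\<Sum>k\<in>K. ?m k * (ev k * \<Phi> k x))"
    using eig x by (intro sum.cong) (auto simp: eigenfunction_def)
  finally have H: "H_op c W (?V t) x = (\<Sum>k\<in>K. ?m k * (ev k * \<Phi> k x))" .
  show "(\<lambda>s. ?V s x) differentiable (at t)"
    using der by (rule differentiableI_vector)
  show "vector_derivative (\<lambda>s. ?V s x) (at t) - \<i> * H_op c W (?V t) x = \<i> * g x * ?e"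
    unfolding vector_derivative_at[OF der] H g[OF x]
    by (simp add: sum_distrib_left sum_distrib_right sum_subtractf[symmetric] algebra_simps del: sum_subtractf)
qed

text \<open>In coordinates, the operator is affine and diagonal with fixed point \<open>p\<close>. By uniqueness the chosen
  solution may be replaced by the explicit one under the integral.\<close>

lemma G_op_modes:
  fixes \<Phi> :: "'k \<Rightarrow> 'a::euclidean_space \<Rightarrow> complex"
  assumes "open D" "T > 0" "finite K"
    and "\<And>k. k \<in> K \<Longrightarrow> eigenfunction D c W (ev k) (\<Phi> k)"
    and "\<And>x. x \<in> D \<Longrightarrow> g x = (\<Sum>k\<in>K. gc k * \<Phi> k x)"
    and "\<And>k. k \<in> K \<Longrightarrow> (ev k + of_real (\<omega>\<^sup>2)) * p k = - gc k"
    and "\<And>x. x \<in> closure D \<Longrightarrow> v x = (\<Sum>k\<in>K. a k * \<Phi> k x)"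
    and x: "x \<in> closure D"
  shows "G_op D c W \<omega> T g v x
           = (\<Sum>k\<in>K. (p k + mode_factor T (ev k + of_real (\<omega>\<^sup>2)) * (a k - p k)) * \<Phi> k x)"
proof -
  define V where "V t x = (\<Sum>k\<in>K. mode_solution (ev k) \<omega> (p k) (a k) t * \<Phi> k x)" for t x
  define U where "U = (SOME V. solves_evolution D c W \<omega> T g v V)"
  have V: "solves_evolution D c W \<omega> T g v V"
    unfolding V_def[abs_def] by (rule solves_evolution_modes[OF assms(1-7)])
  then have U: "solves_evolution D c W \<omega> T g v U"
    unfolding U_def by (rule someI[of "solves_evolution D c W \<omega> T g v"])
  have "U t x = V t x" if "t \<in> {0..T}" for t
    using evolution_unique[OF assms(1) U V that x] .
  then have "integral {0..T} (\<lambda>t. exp (\<i> * of_real (\<omega>\<^sup>2 * t)) * U t x)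
      = integral {0..T} (\<lambda>t. \<Sum>k\<in>K. exp (\<i> * of_real (\<omega>\<^sup>2 * t)) * mode_solution (ev k) \<omega> (p k) (a k) t * \<Phi> k x)"
    by (intro integral_cong) (simp add: V_def sum_distrib_left mult.assoc)
  also have "\<dots> = (\<Sum>k\<in>K. of_real T * (p k + mode_factor T (ev k + of_real (\<omega>\<^sup>2)) * (a k - p k)) * \<Phi> k x)"
    using assms(2,3) by (intro integral_unique has_integral_sum has_integral_mult_left has_integral_mode_solution)
  finally show ?thesis
    unfolding G_op_def U_def[symmetric] using assms(2)
    by (simp add: sum_distrib_left mult.assoc)
qed

lemma iterate_G_op_modes:
  fixes \<Phi> :: "'k \<Rightarrow> 'a::euclidean_space \<Rightarrow> complex"
  assumes "open D" "T > 0" "finite K"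
    and "\<And>k. k \<in> K \<Longrightarrow> eigenfunction D c W (ev k) (\<Phi> k)"
    and "\<And>x. x \<in> D \<Longrightarrow> g x = (\<Sum>k\<in>K. gc k * \<Phi> k x)"
    and "\<And>k. k \<in> K \<Longrightarrow> (ev k + of_real (\<omega>\<^sup>2)) * p k = - gc k"
    and "x \<in> closure D"
  shows "(G_op D c W \<omega> T g ^^ n) (\<lambda>x. 0) x
           = (\<Sum>k\<in>K. (1 - mode_factor T (ev k + of_real (\<omega>\<^sup>2)) ^ n) * p k * \<Phi> k x)"
  using assms(7)
proof (induction n arbitrary: x)
  case (Suc n)
  have "(G_op D c W \<omega> T g ^^ Suc n) (\<lambda>x. 0) x = G_op D c W \<omega> T g ((G_op D c W \<omega> T g ^^ n) (\<lambda>x. 0)) x"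
    by simp
  also have "\<dots> = (\<Sum>k\<in>K. (p k + mode_factor T (ev k + of_real (\<omega>\<^sup>2)) *
      ((1 - mode_factor T (ev k + of_real (\<omega>\<^sup>2)) ^ n) * p k - p k)) * \<Phi> k x)"
    by (rule G_op_modes[OF assms(1-6) Suc.IH Suc.prems])
  also have "\<dots> = (\<Sum>k\<in>K. (1 - mode_factor T (ev k + of_real (\<omega>\<^sup>2)) ^ Suc n) * p k * \<Phi> k x)"
    by (intro sum.cong) (simp_all add: algebra_simps)
  finally show ?case .
qed simp

lemma uniform_limit_lincomb:
  fixes f :: "'k \<Rightarrow> 'a \<Rightarrow> complex" and a :: "'k \<Rightarrow> nat \<Rightarrow> complex"
  assumes "\<And>k. k \<in> K \<Longrightarrow> a k \<longlonglongrightarrow> b k" "\<And>k. k \<in> K \<Longrightarrow> bounded (f k ` S)"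
  shows "uniform_limit S (\<lambda>n x. \<Sum>k\<in>K. a k n * f k x) (\<lambda>x. \<Sum>k\<in>K. b k * f k x) sequentially"
proof -
  have "uniform_limit S (\<lambda>n x. a k n * f k x) (\<lambda>x. b k * f k x) sequentially" if k: "k \<in> K" for k
  proof -
    have "uniform_limit S (\<lambda>n x. a k n) (\<lambda>x. b k) sequentially"
      using assms(1)[OF k] by (auto simp: uniform_limit_iff tendsto_iff)
    then show ?thesis
      using assms(2)[OF k]
      by (intro uniform_lim_mult uniform_limit_const)
        (auto intro: finite_imp_bounded finite_subset[of _ "{b k}"])
  qed
  then show ?thesis
    by (induction K rule: infinite_finite_induct) (auto intro!: uniform_limit_const uniform_limit_add)
qed

section \<open>Convergence to the Helmholtz solution\<close>

theorem theorem2p3: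
  fixes \<Omega> \<Omega>s :: "'a::euclidean_space set"
    and c W :: "'a \<Rightarrow> real"
    and \<omega> T :: real
    and K :: "'k set"
    and \<Phi> :: "'k \<Rightarrow> 'a \<Rightarrow> complex"
    and ev :: "'k \<Rightarrow> complex"
    and gc :: "'k \<Rightarrow> complex"
    and g :: "'a \<Rightarrow> complex"
  assumes "open \<Omega>s" "bounded \<Omega>s" "open \<Omega>" "\<Omega> \<subseteq> \<Omega>s"
    and "\<And>x. x \<in> \<Omega>s \<Longrightarrow> c x > 0"
    and "smooth_on W \<Omega>s" "\<And>x. x \<in> \<Omega>s \<Longrightarrow> W x \<ge> 0" "\<And>x. x \<in> \<Omega> \<Longrightarrow> W x = 0"
    and "T > 0"
    and "finite K" "K \<noteq> {}"
    and "\<And>k. k \<in> K \<Longrightarrow> eigenfunction \<Omega>s c W (ev k) (\<Phi> k)"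
    and "\<And>x. x \<in> \<Omega>s \<Longrightarrow> g x = (\<Sum>k\<in>K. gc k * \<Phi> k x)"
    and "Min ((\<lambda>k. Im (ev k)) ` K) \<ge> 0"
    and "Max ((\<lambda>k. cmod (ev k + of_real (\<omega>\<^sup>2))) ` K) * T > 2"
    and nonresonant: "\<And>k. k \<in> K \<Longrightarrow> gc k \<noteq> 0 \<Longrightarrow> ev k + of_real (\<omega>\<^sup>2) \<noteq> 0"
  shows "\<exists>u. uniform_limit (closure \<Omega>s) (\<lambda>n. (G_op \<Omega>s c W \<omega> T g ^^ n) (\<lambda>x. 0)) u sequentially
           \<and> solves_helmholtz \<Omega>s c W \<omega> g u"
proof -
  define \<mu> where "\<mu> k = ev k + of_real (\<omega>\<^sup>2)" for k
  define p where "p k = - gc k / \<mu> k" for k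
  define u where "u x = (\<Sum>k\<in>K. p k * \<Phi> k x)" for x
  have Im: "Im (\<mu> k) \<ge> 0" if "k \<in> K" for k
    using assms(10,11,14) that by (simp add: \<mu>_def)
  have p: "(ev k + of_real (\<omega>\<^sup>2)) * p k = - gc k" if "k \<in> K" for k
    using nonresonant[OF that] by (auto simp: p_def \<mu>_def)
  have dir: "\<Phi> k \<in> dirichlet_space \<Omega>s" if "k \<in> K" for k
    using assms(12)[OF that] by (simp add: eigenfunction_def)
  have "(\<lambda>n. (1 - mode_factor T (\<mu> k) ^ n) * p k) \<longlonglongrightarrow> p k" if "k \<in> K" for k
  proof (cases "\<mu> k = 0")
    \<comment> \<open>Division by zero gives \<open>p k = 0\<close>, the right amplitude for a mode that is not excited.\<close>
    case True
    then show ?thesis by (simp add: p_def)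
  next
    case False
    then have "(\<lambda>n. mode_factor T (\<mu> k) ^ n) \<longlonglongrightarrow> 0"
      by (intro LIMSEQ_power_zero norm_mode_factor_less_1[OF \<open>T > 0\<close> _ Im[OF that]])
    then have "(\<lambda>n. (1 - mode_factor T (\<mu> k) ^ n) * p k) \<longlonglongrightarrow> (1 - 0) * p k"
      by (intro tendsto_mult tendsto_diff tendsto_const)
    then show ?thesis by simp
  qed
  moreover have "bounded (\<Phi> k ` closure \<Omega>s)" if "k \<in> K" for k
    using dir[OF that] assms(2)
    by (intro compact_imp_bounded compact_continuous_image) (auto simp: dirichlet_space_def)
  ultimately have "uniform_limit (closure \<Omega>s)
      (\<lambda>n x. \<Sum>k\<in>K. (1 - mode_factor T (\<mu> k) ^ n) * p k * \<Phi> k x) (\<lambda>x. \<Sum>k\<in>K. p k * \<Phi> k x) sequentially"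
    by (rule uniform_limit_lincomb)
  moreover have "(G_op \<Omega>s c W \<omega> T g ^^ n) (\<lambda>x. 0) x
      = (\<Sum>k\<in>K. (1 - mode_factor T (\<mu> k) ^ n) * p k * \<Phi> k x)" if "x \<in> closure \<Omega>s" for n x
    unfolding \<mu>_def by (rule iterate_G_op_modes[OF assms(1,9,10,12,13) p that])
  ultimately have "uniform_limit (closure \<Omega>s) (\<lambda>n. (G_op \<Omega>s c W \<omega> T g ^^ n) (\<lambda>x. 0)) u sequentially"
    unfolding uniform_limit_iff u_def by simp
  moreover have "solves_helmholtz \<Omega>s c W \<omega> g u"
    unfolding solves_helmholtz_def
  proof (intro conjI ballI)
    show "u \<in> dirichlet_space \<Omega>s"
      unfolding u_def[abs_def] by (rule dirichlet_space_lincomb[OF assms(1) dir])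
    fix x assume x: "x \<in> \<Omega>s"
    have "H_op c W u x = (\<Sum>k\<in>K. p k * H_op c W (\<Phi> k) x)"
      using dir x by (intro H_op_lincomb[OF assms(1)]) (auto simp: dirichlet_space_def u_def)
    also have "\<dots> = (\<Sum>k\<in>K. p k * (ev k * \<Phi> k x))"
      using assms(12) x by (intro sum.cong) (auto simp: eigenfunction_def)
    finally have "of_real (\<omega>\<^sup>2) * u x + H_op c W u x
        = (\<Sum>k\<in>K. (ev k + of_real (\<omega>\<^sup>2)) * p k * \<Phi> k x)"
      by (simp add: u_def sum_distrib_left sum.distrib algebra_simps)
    also have "\<dots> = (\<Sum>k\<in>K. - gc k * \<Phi> k x)"
      using p by (intro sum.cong) auto
    also have "\<dots> = - g x"
      using assms(13)[OF x] by (simp add: sum_negf)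
    finally show "of_real (\<omega>\<^sup>2) * u x + H_op c W u x = - g x" .
  qed
  ultimately show ?thesis by blast
qed

end
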